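(* For each nonempty closed subset $C$ of $\mathbb{S}$, the following conditions are equivalent: (i) $C$ is connected; (ii) $C$ is a $d_1$-Chebyshev set in $\mathbb{S}$; (iii) $C$ is a $d_2$-Chebyshev set in $\mathbb{S}$.
   Context: The underlying axiom system is ZF (no form of the axiom of choice is assumed). The set $\mathbb{S}$ (symmetrized max-plus algebra). Let $\varepsilon=-\infty$, $\mathbb{R}_\varepsilon=\mathbb{R}\cup\{\varepsilon\}$, $e^{-\infty}=\exp(-\infty)=0$. On $\mathbb{R}_\varepsilon\times\mathbb{R}_\varepsilon$ put $(a,b)\bigtriangledown(c,d)$ iff $\max(a,d)=\max(b,c)$, and put $(a,b)\sim(c,d)$ iff $(a,b)\bigtriangledown(c,d)$ in case $a\neq b$ and $c\neq d$, and iff $(a,b)=(c,d)$ otherwise. Then $\mathbb{S}=(\mathbb{R}_\varepsilon\times\mathbb{R}_\varepsilon)/_\sim$. For $r\in\mathbb{R}_\varepsilon$, the elements $\oplus r$, $\ominus r$, $r^\bullet$ of $\mathbb{S}$ are the classes of $(r,\varepsilon)$, $(\varepsilon,r)$, $(r,r)$. Every element of $\mathbb{S}$ has one of these forms, and the representation is unique except that $\oplus\varepsilon=\ominus\varepsilon=\varepsilon^\bullet$. If $a\in\{\oplus r,\ominus r,r^\bullet\}$, put $|a|=r$ and let $\operatorname{sgn}(a)$ be the corresponding sign $\oplus$, $\ominus$ or $\bullet$ (ambiguous only for $a=\varepsilon^\bullet$, which does not affect the formulas below). The canonical embedding $\Phi:\mathbb{S}\to\mathbb{C}$ is $\Phi(\oplus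 r)=\theta e^r$, $\Phi(\ominus r)=\theta^2e^r$, $\Phi(r^\bullet)=e^r$, where $\theta=\frac{-1+\sqrt3 i}{2}$. The Euclidean distance in $\mathbb{S}$ is $d_1(a,b)=|\Phi(a)-\Phi(b)|$ (Euclidean distance in $\mathbb{C}$). The inner distance $d_2$ is $d_2(a,b)=\left|\exp|a|-\exp|b|\right|$ if $\operatorname{sgn}(a)=\operatorname{sgn}(b)$ and $d_2(a,b)=\exp|a|+\exp|b|$ if $\operatorname{sgn}(a)\neq\operatorname{sgn}(b)$. The topology of $\mathbb{S}$ is the smallest one making $\Phi$ continuous; both $d_1$ and $d_2$ induce it. For a metric space $(X,d)$ and nonempty $K\subseteq X$, let $P_{d,K}(x)=\{y\in K: d(x,y)=d(x,K)\}$ where $d(x,K)=\inf_{y\in K}d(x,y)$; $P_{d,\emptyset}(x)=\emptyset$. $K$ is a $d$-Chebyshev set in $X$ if $P_{d,K}(x)$ is a singleton for each $x\in X$. *)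

theory Defs
  imports "HOL-Analysis.Analysis" "HOL-Library.Option_ord"
begin

section \<open>The symmetrized max-plus algebra\<close>

text \<open>The set \<open>\<real> \<union> {-\<infinity>}\<close> is represented by the type \<open>real option\<close> with the linear order of
  Option_ord: the least element \<open>None\<close> is \<open>-\<infinity>\<close>, and \<open>Some x\<close> is the real number \<open>x\<close>.\<close>

type_synonym reps = "real option"

abbreviation eps :: reps where
  "eps \<equiv> None"

definition exp_reps :: "reps \<Rightarrow> real" where
  "exp_reps r = (case r of None \<Rightarrow> 0 | Some x \<Rightarrow> exp x)"

definition balances :: "reps \<times> reps \<Rightarrow> reps \<times> reps \<Rightarrow> bool" where
  "balances p q \<longleftrightarrow> max (fst p) (snd q) = max (snd p) (fst q)"

definition symm_rel :: "reps \<times> reps \<Rightarrow> reps \<times> reps \<Rightarrow> bool" where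
  "symm_rel p q \<longleftrightarrow>
     (if fst p \<noteq> snd p \<and> fst q \<noteq> snd q then balances p q else p = q)"

lemma symm_rel_iff:
  "symm_rel p q \<longleftrightarrow>
     p = q \<or> fst p > snd p \<and> fst q > snd q \<and> fst p = fst q \<or>
     fst p < snd p \<and> fst q < snd q \<and> snd p = snd q"
proof (cases p; cases q)
  fix a b c d assume "p = (a, b)" "q = (c, d)"
  then show ?thesis
    by (cases a b rule: linorder_cases; cases c d rule: linorder_cases)
       (auto simp: symm_rel_def balances_def max_def split: if_splits)
qed

lemma equivp_symm_rel: "equivp symm_rel"
  by (rule equivpI) (auto simp: reflp_def symp_def transp_def symm_rel_iff)

quotient_type smp = "reps \<times> reps" / symm_rel
  by (rule equivp_symm_rel)

lift_definition oplus :: "reps \<Rightarrow> smp" is "\<lambda>r. (r, eps)" .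

lift_definition ominus :: "reps \<Rightarrow> smp" is "\<lambda>r. (eps, r)" .

lift_definition bullet :: "reps \<Rightarrow> smp" is "\<lambda>r. (r, r)" .

text \<open>The modulus and the sign are computed on representatives; the lemmas below state their values
  on \<open>oplus r\<close>, \<open>ominus r\<close>, \<open>bullet r\<close>. The ambiguous sign of \<open>bullet eps\<close> is fixed to be \<open>Bal\<close>.\<close>

datatype sign = Pos | Neg | Bal

lift_definition modulus :: "smp \<Rightarrow> reps" is "\<lambda>(a, b). max a b"
  by (auto simp: symm_rel_iff)

lift_definition sgn_smp :: "smp \<Rightarrow> sign" is
  "\<lambda>(a, b). if b < a then Pos else if a < b then Neg else Bal"
  by (auto simp: symm_rel_iff)

lemma eps_less_iff: "eps < r \<longleftrightarrow> r \<noteq> eps"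
  by (cases r) auto

lemma modulus_simps [simp]:
  "modulus (oplus r) = r" "modulus (ominus r) = r" "modulus (bullet r) = r"
proof -
  have "max r eps = r" "max eps r = r"
    by (cases r; simp add: max_def)+
  then show "modulus (oplus r) = r" "modulus (ominus r) = r" "modulus (bullet r) = r"
    by (transfer; simp)+
qed

lemma sgn_smp_simps:
  "r \<noteq> eps \<Longrightarrow> sgn_smp (oplus r) = Pos"
  "r \<noteq> eps \<Longrightarrow> sgn_smp (ominus r) = Neg"
  "sgn_smp (bullet r) = Bal"
  by (transfer, simp add: eps_less_iff)+

lemma oplus_eps: "oplus eps = bullet eps" and ominus_eps: "ominus eps = bullet eps"
  by (transfer, simp add: symm_rel_iff)+

lemma smp_cases:
  obtains (oplus) r where "r \<noteq> eps" "x = oplus r"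
  | (ominus) r where "r \<noteq> eps" "x = ominus r"
  | (bullet) r where "x = bullet r"
proof -
  have "(\<exists>r. r \<noteq> eps \<and> x = oplus r) \<or> (\<exists>r. r \<noteq> eps \<and> x = ominus r) \<or> (\<exists>r. x = bullet r)"
  proof (transfer, goal_cases)
    case (1 p)
    obtain a b where p: "p = (a, b)" by (cases p)
    show ?case
    proof (cases a b rule: linorder_cases)
      case less
      then have "b \<noteq> eps" "symm_rel p (eps, b)"
        by (cases b; simp add: p symm_rel_iff)+
      then show ?thesis by blast
    next
      case equal
      then have "symm_rel p (a, a)"
        by (simp add: p symm_rel_iff)
      then show ?thesis by blast
    next
      case greater
      then have "a \<noteq> eps" "symm_rel p (a, eps)"
        by (cases a; simp add: p symm_rel_iff)+
      then show ?thesis by blast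
    qed
  qed
  then show thesis using that by blast
qed

lemma smp_eqI: "modulus x = modulus y \<Longrightarrow> sgn_smp x = sgn_smp y \<Longrightarrow> x = y"
  by (cases x rule: smp_cases; cases y rule: smp_cases) (auto simp: sgn_smp_simps)

lemma modulus_eq_eps_iff: "modulus x = eps \<longleftrightarrow> x = bullet eps"
  by (cases x rule: smp_cases) (auto dest: arg_cong[of _ _ modulus])


section \<open>Embedding, distances and topology\<close>

definition theta :: complex where
  "theta = (-1 + of_real (sqrt 3) * \<i>) / 2"

definition Phi :: "smp \<Rightarrow> complex" where
  "Phi a = (case sgn_smp a of Pos \<Rightarrow> theta | Neg \<Rightarrow> theta\<^sup>2 | Bal \<Rightarrow> 1)
             * of_real (exp_reps (modulus a))"

lemma Phi_simps:
  "Phi (oplus r) = theta * of_real (exp_reps r)"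
  "Phi (ominus r) = theta\<^sup>2 * of_real (exp_reps r)"
  "Phi (bullet r) = of_real (exp_reps r)"
  by (cases r; simp add: Phi_def sgn_smp_simps oplus_eps ominus_eps exp_reps_def)+

definition d1 :: "smp \<Rightarrow> smp \<Rightarrow> real" where
  "d1 a b = dist (Phi a) (Phi b)"

definition d2 :: "smp \<Rightarrow> smp \<Rightarrow> real" where
  "d2 a b = (if sgn_smp a = sgn_smp b
     then \<bar>exp_reps (modulus a) - exp_reps (modulus b)\<bar>
     else exp_reps (modulus a) + exp_reps (modulus b))"

definition smp_topology :: "smp topology" where
  "smp_topology = pullback_topology UNIV Phi euclidean"


section \<open>Chebyshev sets\<close>

context Metric_space
begin

definition dist_to :: "'a \<Rightarrow> 'a set \<Rightarrow> real" where
  "dist_to x K = (INF y\<in>K. d x y)"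

definition metric_proj :: "'a set \<Rightarrow> 'a \<Rightarrow> 'a set" where
  "metric_proj K x = {y \<in> K. d x y = dist_to x K}"

definition Chebyshev :: "'a set \<Rightarrow> bool" where
  "Chebyshev K \<longleftrightarrow> K \<subseteq> M \<and> (\<forall>x\<in>M. is_singleton (metric_proj K x))"

end

lemma exp_reps_nonneg [simp]: "0 \<le> exp_reps r"
  by (cases r) (auto simp: exp_reps_def)

lemma exp_reps_eq_iff [simp]: "exp_reps r = exp_reps s \<longleftrightarrow> r = s"
  by (cases r; cases s) (auto simp: exp_reps_def)

lemma exp_reps_eq_0_iff [simp]: "exp_reps r = 0 \<longleftrightarrow> r = eps"
  by (cases r) (auto simp: exp_reps_def)

lemma inj_Phi: "inj Phi"
proof (rule injI)
  fix x y assume eq: "Phi x = Phi y"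
  have [simp]: "Re theta = - 1 / 2" "Im theta = sqrt 3 / 2"
      "Re (theta\<^sup>2) = - 1 / 2" "Im (theta\<^sup>2) = - sqrt 3 / 2"
    by (simp_all add: theta_def power2_eq_square)
  have pos: "r \<noteq> eps \<Longrightarrow> 0 < exp_reps r" for r
    by (auto simp: exp_reps_def)
  show "x = y"
  proof (cases x rule: smp_cases; cases y rule: smp_cases)
  qed (use eq pos exp_reps_nonneg in \<open>force simp: Phi_simps complex_eq_iff\<close>)+
qed

interpretation d1: Metric_space UNIV d1
  by standard (auto simp: d1_def dist_commute dist_triangle inj_eq[OF inj_Phi])

interpretation d2: Metric_space UNIV d2
proof
  fix x y z
  show "0 \<le> d2 x y" "d2 x y = d2 y x"
    by (auto simp: d2_def)
  show "d2 x y = 0 \<longleftrightarrow> x = y"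
    by (auto simp: d2_def add_nonneg_eq_0_iff modulus_eq_eps_iff intro: smp_eqI)
  show "d2 x z \<le> d2 x y + d2 y z"
    using exp_reps_nonneg[of "modulus x"] exp_reps_nonneg[of "modulus y"]
      exp_reps_nonneg[of "modulus z"] unfolding d2_def by (smt (verit))
qed

end

theory Submission
  imports Defs
begin

text \<open>The space \<open>\<S>\<close> is a tripod: three closed half-lines (rays), one for each sign, glued at the
  common origin \<open>bullet eps\<close>. On a ray both metrics are the usual distance of moduli
  (after \<open>exp\<close>), and between points with moduli \<open>u\<close>, \<open>v\<close> on different rays they are
  \<open>sqrt (u\<^sup>2 + u v + v\<^sup>2)\<close> and \<open>u + v\<close> respectively; both are bi-Lipschitz equivalent, they induce
  the topology of \<open>\<S>\<close>, and their closed balls are compact. Hence nearest points in closed sets exist,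
  and being a Chebyshev set only means that they are unique.

  That a Chebyshev set is connected has nothing to do with the tripod: it holds in every connected
  metric space with compact closed balls (\<open>Chebyshev_imp_connectedin\<close>). If a closed set is
  split into two closed disjoint pieces, the points strictly closer to one piece and those strictly
  closer to the other form two disjoint nonempty open sets, so some point is equally far from both
  pieces and has a nearest point in each.

  Conversely, a point on a ray separates the part of the ray beyond it from the rest of the tripod, so
  a connected set that meets both sides contains it (\<open>connectedin_cut_point\<close>). If \<open>x\<close> had two
  nearest points \<open>p \<noteq> q\<close> in a connected set \<open>C\<close>, then \<open>x\<close> or the origin would separate \<open>p\<close> from \<open>q\<close> and
  be closer to \<open>x\<close> than they are (\<open>nearest_point_unique\<close>); this separating point would lie in \<open>C\<close>,
  a contradiction.
  The argument uses only that the distance to a point on another ray increases strictly with its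
  modulus, so it treats both metrics at once.\<close>

section \<open>Nearest points in metric spaces with compact balls\<close>

context Metric_space
begin

lemma continuous_map_dist_from: "x \<in> M \<Longrightarrow> continuous_map mtopology euclideanreal (d x)"
  unfolding continuous_map_from_metric
proof (intro conjI ballI allI impI)
  fix a U assume x: "x \<in> M" and a: "a \<in> M" and U: "openin euclideanreal U \<and> d x a \<in> U"
  then obtain e where e: "e > 0" "\<And>t. \<bar>t - d x a\<bar> < e \<Longrightarrow> t \<in> U"
    by (auto simp: open_dist dist_real_def)
  have "d x y \<in> U" if y: "y \<in> M" "d a y < e" for y
  proof (rule e(2))
    show "\<bar>d x y - d x a\<bar> < e"
      using triangle[of x a y] triangle[of x y a] commute[of a y] x a y by linarith
  qed
  then show "\<exists>r>0. \<forall>y. y \<in> M \<and> d a y < r \<longrightarrow> d x y \<in> U"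
    using e(1) by blast
qed auto

lemma nearest_point_exists:
  assumes balls: "\<And>x r. compactin mtopology (mcball x r)"
    and K: "closedin mtopology K" "K \<noteq> {}" and x: "x \<in> M"
  obtains y where "y \<in> K" "\<And>z. z \<in> K \<Longrightarrow> d x y \<le> d x z"
proof -
  obtain k where k: "k \<in> K" using K by blast
  have KM: "K \<subseteq> M" using K closedin_subset by fastforce
  define L where "L = K \<inter> mcball x (d x k)"
  have "compactin mtopology L"
    unfolding L_def by (intro closed_Int_compactin K balls)
  then have "compact (d x ` L)"
    using image_compactin[OF _ continuous_map_dist_from[OF x]] by fastforce
  moreover have "k \<in> L" using k KM x by (auto simp: L_def)
  ultimately obtain y where y: "y \<in> L" "\<And>z. z \<in> L \<Longrightarrow> d x y \<le> d x z"
    using compact_attains_inf[of "d x ` L"] by blast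
  have "d x y \<le> d x z" if "z \<in> K" for z
  proof (cases "d x z \<le> d x k")
    case True
    then show ?thesis using y(2)[of z] that KM x by (auto simp: L_def)
  next
    case False
    then show ?thesis using y(2)[OF \<open>k \<in> L\<close>] by linarith
  qed
  then show thesis using that y(1) by (auto simp: L_def)
qed

lemma metric_proj_eq_nearest_points:
  assumes "K \<subseteq> M" "K \<noteq> {}" "x \<in> M"
  shows "metric_proj K x = {y \<in> K. \<forall>z\<in>K. d x y \<le> d x z}"
proof -
  have bdd: "bdd_below (d x ` K)"
    by (rule bdd_belowI[of _ 0]) auto
  have "d x y = dist_to x K \<longleftrightarrow> (\<forall>z\<in>K. d x y \<le> d x z)" if "y \<in> K" for y
    unfolding dist_to_def
    using cINF_lower[OF bdd] cINF_greatest[OF assms(2), of "d x y" "d x"] that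
    by (metis order_antisym)
  then show ?thesis by (auto simp: metric_proj_def)
qed

lemma Chebyshev_iff_nearest_point_unique:
  assumes balls: "\<And>x r. compactin mtopology (mcball x r)"
    and K: "closedin mtopology K" "K \<noteq> {}"
  shows "Chebyshev K \<longleftrightarrow>
    (\<forall>x\<in>M. \<forall>p\<in>K. \<forall>q\<in>K. (\<forall>z\<in>K. d x p \<le> d x z) \<longrightarrow> (\<forall>z\<in>K. d x q \<le> d x z) \<longrightarrow> p = q)"
proof -
  have KM: "K \<subseteq> M" using K closedin_subset by fastforce
  have "is_singleton (metric_proj K x) \<longleftrightarrow>
      (\<forall>p\<in>K. \<forall>q\<in>K. (\<forall>z\<in>K. d x p \<le> d x z) \<longrightarrow> (\<forall>z\<in>K. d x q \<le> d x z) \<longrightarrow> p = q)"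
    if x: "x \<in> M" for x
  proof -
    define P where "P = metric_proj K x"
    have P: "y \<in> P \<longleftrightarrow> y \<in> K \<and> (\<forall>z\<in>K. d x y \<le> d x z)" for y
      by (simp add: P_def metric_proj_eq_nearest_points[OF KM K(2) x])
    obtain y where "y \<in> K" "\<And>z. z \<in> K \<Longrightarrow> d x y \<le> d x z"
      using nearest_point_exists[OF balls K x] by blast
    then have "y \<in> P" by (simp add: P)
    then have "is_singleton P \<longleftrightarrow> (\<forall>p\<in>P. \<forall>q\<in>P. p = q)"
      by (auto simp: is_singleton_def)
    then show ?thesis
      unfolding P_def[symmetric] by (simp add: P Ball_def imp_conjL)
  qed
  then show ?thesis using KM by (simp add: Chebyshev_def)
qed

text \<open>The distances to nearest points are \<open>1\<close>-Lipschitz, so a strict inequality between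
  the distances to two closed sets persists nearby. The condition is phrased
  with elements of the two sets instead of the distances to them.\<close>

lemma openin_closer_points:
  assumes balls: "\<And>x r. compactin mtopology (mcball x r)"
    and A: "A \<subseteq> M" and B: "closedin mtopology B" "B \<noteq> {}"
  shows "openin mtopology {x \<in> M. \<exists>a\<in>A. \<forall>b\<in>B. d x a < d x b}"
  unfolding openin_mtopology
proof (intro conjI allI impI)
  fix x assume "x \<in> {x \<in> M. \<exists>a\<in>A. \<forall>b\<in>B. d x a < d x b}"
  then obtain a where x: "x \<in> M" and a: "a \<in> A" "\<And>b. b \<in> B \<Longrightarrow> d x a < d x b" by blast
  have BM: "B \<subseteq> M" using B closedin_subset by fastforce
  obtain b where b: "b \<in> B" "\<And>z. z \<in> B \<Longrightarrow> d x b \<le> d x z"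
    using nearest_point_exists[OF balls B x] by blast
  define r where "r = (d x b - d x a) / 2"
  have "r > 0" using a(2)[OF b(1)] by (simp add: r_def)
  moreover have "d y a < d y z" if y: "y \<in> mball x r" and z: "z \<in> B" for y z
  proof -
    have "y \<in> M" "d x y < r" using y by auto
    moreover have "d y a \<le> d x y + d x a"
      using triangle[of y x a] \<open>y \<in> M\<close> x a(1) A commute[of x y] by auto
    moreover have "d x z \<le> d x y + d y z"
      using triangle[of x y z] \<open>y \<in> M\<close> x z BM by auto
    ultimately show ?thesis using b(2)[OF z] unfolding r_def by argo
  qed
  ultimately show "\<exists>r>0. mball x r \<subseteq> {x \<in> M. \<exists>a\<in>A. \<forall>b\<in>B. d x a < d x b}"
    using a(1) by (intro exI[of _ r]) fastforce
qed auto

text \<open>If a closed set fell into two closed pieces, then, the space being connected, some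
  point would have the same distance to both and hence a nearest point in each.\<close>

lemma Chebyshev_imp_connectedin:
  assumes balls: "\<And>x r. compactin mtopology (mcball x r)"
    and conn: "connected_space mtopology"
    and C: "closedin mtopology C" "Chebyshev C"
  shows "connectedin mtopology C"
proof (rule ccontr)
  have CM: "C \<subseteq> M" using C closedin_subset by fastforce
  assume "\<not> connectedin mtopology C"
  then obtain E1 E2 where E: "closedin mtopology E1" "closedin mtopology E2" "C \<subseteq> E1 \<union> E2"
      "E1 \<inter> E2 \<inter> C = {}" "E1 \<inter> C \<noteq> {}" "E2 \<inter> C \<noteq> {}"
    using CM by (auto simp: connectedin_closedin)
  define A B where "A = E1 \<inter> C" and "B = E2 \<inter> C"
  have A: "closedin mtopology A" "A \<noteq> {}" "A \<subseteq> M"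
    and B: "closedin mtopology B" "B \<noteq> {}" "B \<subseteq> M"
    and AB: "A \<inter> B = {}" "C = A \<union> B"
    using E C CM by (auto simp: A_def B_def)
  define closer where "closer = (\<lambda>A B. {x \<in> M. \<exists>a\<in>A. \<forall>b\<in>B. d x a < d x b})"
  have op: "openin mtopology (closer A B)" "openin mtopology (closer B A)"
    unfolding closer_def using openin_closer_points[OF balls] A B by blast+
  have subset: "P \<subseteq> closer P Q" if "P \<subseteq> M" "Q \<subseteq> M" "P \<inter> Q = {}" for P Q
    unfolding closer_def
  proof
    fix x assume x: "x \<in> P"
    have "d x x < d x q" if q: "q \<in> Q" for q
    proof -
      have "x \<in> M" "q \<in> M" "x \<noteq> q"
        using x q \<open>P \<subseteq> M\<close> \<open>Q \<subseteq> M\<close> \<open>P \<inter> Q = {}\<close> by auto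
      then show ?thesis using mdist_pos_less[of x q] mdist_zero[of x] by simp
    qed
    then show "x \<in> {x \<in> M. \<exists>a\<in>P. \<forall>b\<in>Q. d x a < d x b}"
      using x \<open>P \<subseteq> M\<close> by blast
  qed
  have "closer A B \<noteq> {}" "closer B A \<noteq> {}"
    using subset[of A B] subset[of B A] A B AB by blast+
  moreover have "closer A B \<inter> closer B A = {}"
    unfolding closer_def by (blast dest: order.asym)
  ultimately have "\<not> M \<subseteq> closer A B \<union> closer B A"
    using conn op by (auto simp: connected_space_def)
  then obtain x where x: "x \<in> M" "x \<notin> closer A B" "x \<notin> closer B A" by blast
  obtain a where a: "a \<in> A" "\<And>z. z \<in> A \<Longrightarrow> d x a \<le> d x z"
    using nearest_point_exists[OF balls A(1,2) x(1)] by blast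
  obtain b where b: "b \<in> B" "\<And>z. z \<in> B \<Longrightarrow> d x b \<le> d x z"
    using nearest_point_exists[OF balls B(1,2) x(1)] by blast
  have "d x b \<le> d x a"
    using x a(1) b by (force simp: closer_def)
  moreover have "d x a \<le> d x b"
    using x b(1) a by (force simp: closer_def)
  ultimately have nearest: "\<forall>z\<in>C. d x a \<le> d x z" "\<forall>z\<in>C. d x b \<le> d x z"
    using a b AB(2) by force+
  have ab: "a \<in> C" "b \<in> C" using a(1) b(1) AB(2) by auto
  then have "C \<noteq> {}" by blast
  from iffD1[OF Chebyshev_iff_nearest_point_unique[OF balls C(1) this] C(2)] x(1) ab
  have "(\<forall>z\<in>C. d x a \<le> d x z) \<longrightarrow> (\<forall>z\<in>C. d x b \<le> d x z) \<longrightarrow> a = b" by simp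
  with nearest have "a = b" by simp
  then show False using a(1) b(1) AB(1) by blast
qed

end

section \<open>The two metrics and the topology of the tripod\<close>

text \<open>This is the distance to the origin in both metrics.\<close>

definition radius :: "smp \<Rightarrow> real" where
  "radius x = exp_reps (modulus x)"

lemma radius_nonneg [simp]: "0 \<le> radius x"
  by (simp add: radius_def)

lemma radius_eq_0_iff: "radius x = 0 \<longleftrightarrow> x = bullet eps"
  by (simp add: radius_def modulus_eq_eps_iff)

lemma radius_origin [simp]: "radius (bullet eps) = 0"
  by (simp add: radius_eq_0_iff)

lemma smp_eqI_radius: "sgn_smp x = sgn_smp y \<Longrightarrow> radius x = radius y \<Longrightarrow> x = y"
  by (simp add: radius_def smp_eqI)

lemma d2_eq: "d2 x y =
    (if sgn_smp x = sgn_smp y then \<bar>radius x - radius y\<bar> else radius x + radius y)"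
  by (simp add: d2_def radius_def)

text \<open>Points on different rays are seen from the origin under an angle of \<open>120\<close> degrees, so
  the second case is the law of cosines.\<close>

lemma d1_eq: "d1 x y =
    (if sgn_smp x = sgn_smp y then \<bar>radius x - radius y\<bar>
     else sqrt ((radius x)\<^sup>2 + radius x * radius y + (radius y)\<^sup>2))"
proof -
  define h where "h = Im theta"
  have h: "h * h = 3 / 4" "\<And>t. h * (h * t) = 3 / 4 * t"
    by (simp_all add: h_def theta_def flip: mult.assoc)
  have th: "Re theta = - 1 / 2" "Im theta = h" "Re (theta\<^sup>2) = - 1 / 2" "Im (theta\<^sup>2) = - h"
    by (simp_all add: h_def theta_def power2_eq_square)
  have "(d1 x y)\<^sup>2 = (if sgn_smp x = sgn_smp y then (radius x - radius y)\<^sup>2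
     else (radius x)\<^sup>2 + radius x * radius y + (radius y)\<^sup>2)"
    unfolding d1_def dist_norm cmod_power2 Phi_def radius_def[symmetric]
    by (cases "sgn_smp x"; cases "sgn_smp y")
      (simp_all only: sign.case sign.distinct if_True if_False minus_complex.sel times_complex.sel
         Re_complex_of_real Im_complex_of_real one_complex.sel th, 
       simp_all add: h power2_eq_square algebra_simps)
  moreover have "d1 x y = sqrt ((d1 x y)\<^sup>2)" by simp
  ultimately show ?thesis by simp
qed

lemma d1_le_d2: "d1 x y \<le> d2 x y"
proof (cases "sgn_smp x = sgn_smp y")
  case False
  have "sqrt ((radius x)\<^sup>2 + radius x * radius y + (radius y)\<^sup>2) \<le> radius x + radius y"
    by (rule real_le_lsqrt) (simp_all add: power2_sum)
  then show ?thesis using False by (simp add: d1_eq d2_eq)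
qed (simp add: d1_eq d2_eq)

lemma d2_le_2_d1: "d2 x y \<le> 2 * d1 x y"
proof (cases "sgn_smp x = sgn_smp y")
  case False
  have "(radius x + radius y) / 2 \<le> sqrt ((radius x)\<^sup>2 + radius x * radius y + (radius y)\<^sup>2)"
  proof (rule real_le_rsqrt)
    have "0 \<le> radius x * radius y" by simp
    then show "((radius x + radius y) / 2)\<^sup>2 \<le> (radius x)\<^sup>2 + radius x * radius y + (radius y)\<^sup>2"
      using zero_le_power2[of "radius x"] zero_le_power2[of "radius y"]
      by (simp add: power2_sum power_divide field_simps)
  qed
  then show ?thesis using False by (simp add: d1_eq d2_eq)
qed (simp add: d1_eq d2_eq)

lemma mtopology_d1: "d1.mtopology = smp_topology"
  unfolding topology_eq
proof (intro allI iffI)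
  fix S assume "openin d1.mtopology S"
  then obtain r where r: "\<And>x. x \<in> S \<Longrightarrow> r x > 0 \<and> d1.mball x (r x) \<subseteq> S"
    unfolding d1.openin_mtopology by metis
  define U where "U = (\<Union>x\<in>S. ball (Phi x) (r x))"
  have "y \<in> S" if "Phi y \<in> U" for y
    using that r by (force simp: U_def d1_def)
  moreover have "Phi y \<in> U" if "y \<in> S" for y
    using r[OF that] that by (auto simp: U_def intro!: bexI[of _ y])
  ultimately have "S = Phi -` U" by blast
  moreover have "open U" by (auto simp: U_def)
  ultimately show "openin smp_topology S"
    by (auto simp: smp_topology_def openin_pullback_topology)
next
  fix S assume "openin smp_topology S"
  then obtain U where U: "open U" "S = Phi -` U"
    by (auto simp: smp_topology_def openin_pullback_topology)
  show "openin d1.mtopology S"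
    unfolding d1.openin_mtopology
  proof (intro conjI allI impI)
    fix x assume "x \<in> S"
    then obtain e where "e > 0" "ball (Phi x) e \<subseteq> U"
      using U open_contains_ball by blast
    then show "\<exists>r>0. d1.mball x r \<subseteq> S"
      using U(2) by (intro exI[of _ e]) (auto simp: d1_def)
  qed auto
qed

lemma mtopology_d2: "d2.mtopology = smp_topology"
  unfolding mtopology_d1[symmetric] topology_eq
proof (intro allI iffI)
  fix S
  have 1: "d2.mball x r \<subseteq> d1.mball x r" for x r
  proof
    fix y assume "y \<in> d2.mball x r"
    then show "y \<in> d1.mball x r" using d1_le_d2[of x y] by simp
  qed
  show "openin d2.mtopology S" if "openin d1.mtopology S"
    using that 1 unfolding d1.openin_mtopology d2.openin_mtopology by (meson order_trans)
  have 2: "d1.mball x (r / 2) \<subseteq> d2.mball x r" for x r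
  proof
    fix y assume "y \<in> d1.mball x (r / 2)"
    then show "y \<in> d2.mball x r" using d2_le_2_d1[of x y] by simp
  qed
  show "openin d1.mtopology S" if "openin d2.mtopology S"
    using that 2 unfolding d1.openin_mtopology d2.openin_mtopology
    by (meson half_gt_zero order_trans)
qed

text \<open>The rays are parametrized by the real line, with all negative numbers sent to the origin, so
  that the parametrization is continuous on the whole line.\<close>

definition ray :: "sign \<Rightarrow> real \<Rightarrow> smp" where
  "ray s t = (case s of Pos \<Rightarrow> oplus | Neg \<Rightarrow> ominus | Bal \<Rightarrow> bullet)
               (if 0 < t then Some (ln t) else eps)"

lemma radius_ray: "radius (ray s t) = max 0 t"
  by (cases s) (auto simp: ray_def radius_def exp_reps_def)

lemma sgn_ray: "0 < t \<Longrightarrow> sgn_smp (ray s t) = s"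
  by (cases s) (auto simp: ray_def sgn_smp_simps)

lemma ray_nonpos: "t \<le> 0 \<Longrightarrow> ray s t = bullet eps"
  by (simp add: radius_ray flip: radius_eq_0_iff)

lemma ray_sgn_radius: "ray (sgn_smp x) (radius x) = x"
proof (cases "radius x = 0")
  case True
  then show ?thesis by (simp add: ray_nonpos radius_eq_0_iff)
next
  case False
  then have "0 < radius x" using radius_nonneg[of x] by linarith
  then show ?thesis by (intro smp_eqI_radius) (simp_all add: sgn_ray radius_ray)
qed

lemma d2_ray: "d2 (ray s t) (ray s u) = \<bar>max 0 t - max 0 u\<bar>"
  by (cases "0 < t"; cases "0 < u") (auto simp: d2_eq radius_ray sgn_ray ray_nonpos)

lemma continuous_map_ray: "continuous_map euclideanreal smp_topology (ray s)"
  unfolding mtopology_d2[symmetric] d2.continuous_map_to_metric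
proof (intro ballI allI impI)
  fix t e :: real assume "0 < e"
  moreover have "\<bar>max 0 t - max 0 u\<bar> < e" if "dist t u < e" for u
    using that \<open>0 < e\<close> by (auto simp: dist_real_def max_def)
  ultimately show "\<exists>U. openin euclideanreal U \<and> t \<in> U \<and> (\<forall>u\<in>U. ray s u \<in> d2.mball (ray s t) e)"
    by (intro exI[of _ "ball t e"]) (auto simp: d2_ray)
qed

lemma topspace_smp [simp]: "topspace smp_topology = UNIV"
  unfolding mtopology_d1[symmetric] by simp

lemma connected_space_smp: "connected_space smp_topology"
  unfolding connected_space_subconnected
proof (intro ballI)
  fix x y
  define R where "R = (\<lambda>z. range (ray (sgn_smp z)))"
  have R: "connectedin smp_topology (R z)" "z \<in> R z" "bullet eps \<in> R z" for z
  proof -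
    show "connectedin smp_topology (R z)"
      unfolding R_def by (rule connectedin_continuous_map_image[OF continuous_map_ray]) auto
    show "z \<in> R z" unfolding R_def by (metis rangeI ray_sgn_radius)
    show "bullet eps \<in> R z" unfolding R_def by (metis order_refl rangeI ray_nonpos)
  qed
  then have "connectedin smp_topology (R x \<union> R y)"
    by (intro connectedin_Un) blast+
  then show "\<exists>S. connectedin smp_topology S \<and> x \<in> S \<and> y \<in> S"
    using R(2) by blast
qed

lemma compactin_radius_le: "compactin smp_topology {x. radius x \<le> r}"
proof -
  have "{x. radius x \<le> r} = (\<Union>s\<in>{Pos, Neg, Bal}. ray s ` {0..r})" (is "?L = ?R")
  proof
    show "?L \<subseteq> ?R"
    proof
      fix x assume "x \<in> ?L"
      then have "x \<in> ray (sgn_smp x) ` {0..r}"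
        using ray_sgn_radius[of x, symmetric] by (intro image_eqI[of _ _ "radius x"]) auto
      moreover have "sgn_smp x \<in> {Pos, Neg, Bal}" by (cases "sgn_smp x") auto
      ultimately show "x \<in> ?R" by blast
    qed
  qed (auto simp: radius_ray)
  moreover have "compactin smp_topology (ray s ` {0..r})" for s
    by (rule image_compactin[OF _ continuous_map_ray]) auto
  then have "compactin smp_topology ?R" by (intro compactin_Union) auto
  ultimately show ?thesis by simp
qed

lemma d_origin: "d1 x (bullet eps) = radius x" "d2 x (bullet eps) = radius x"
  by (auto simp: d1_eq d2_eq)

lemma compactin_mcball_d1: "compactin d1.mtopology (d1.mcball x r)"
proof (rule closed_compactin)
  show "compactin d1.mtopology {y. radius y \<le> radius x + r}"
    unfolding mtopology_d1 by (rule compactin_radius_le)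
  show "d1.mcball x r \<subseteq> {y. radius y \<le> radius x + r}"
  proof
    fix y assume "y \<in> d1.mcball x r"
    then show "y \<in> {y. radius y \<le> radius x + r}"
      using d1.triangle[of y x "bullet eps"] d1.commute[of x y] by (simp add: d_origin)
  qed
qed auto

lemma compactin_mcball_d2: "compactin d2.mtopology (d2.mcball x r)"
proof (rule closed_compactin)
  show "compactin d2.mtopology {y. radius y \<le> radius x + r}"
    unfolding mtopology_d2 by (rule compactin_radius_le)
  show "d2.mcball x r \<subseteq> {y. radius y \<le> radius x + r}"
  proof
    fix y assume "y \<in> d2.mcball x r"
    then show "y \<in> {y. radius y \<le> radius x + r}"
      using d2.triangle[of y x "bullet eps"] d2.commute[of x y] by (simp add: d_origin)
  qed
qed auto

section \<open>Connected sets in the tripod\<close>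

text \<open>Removing the point at radius \<open>w\<close> on a ray disconnects the part of this ray beyond it
  from everything else. The case \<open>w = 0\<close> is included: then the removed point is the origin,
  whose own sign need not be \<open>s\<close>.\<close>

lemma connectedin_cut_point:
  assumes C: "connectedin smp_topology C" and w: "0 \<le> w"
    and p: "p \<in> C" "sgn_smp p = s" "w < radius p"
    and q: "q \<in> C" "sgn_smp q \<noteq> s \<or> radius q \<le> w"
  shows "ray s w \<in> C"
proof (rule ccontr)
  let ?z = "ray s w"
  assume z: "?z \<notin> C"
  define W where "W = {y. sgn_smp y = s \<and> w < radius y}"
  define V where "V = {y. (sgn_smp y \<noteq> s \<or> radius y < w) \<and> y \<noteq> ?z}"
  have eqz: "y = ?z" if "sgn_smp y = s" "radius y = w" for y
    using ray_sgn_radius[of y] that by simp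
  have "openin d2.mtopology W"
    unfolding d2.openin_mtopology
  proof (intro conjI allI impI)
    fix y assume "y \<in> W"
    then have "0 < radius y - w" "d2.mball y (radius y - w) \<subseteq> W"
      using w by (auto simp: W_def d2_eq split: if_splits) (smt (verit) radius_nonneg)+
    then show "\<exists>r>0. d2.mball y r \<subseteq> W" by blast
  qed auto
  moreover have "openin d2.mtopology V"
    unfolding d2.openin_mtopology
  proof (intro conjI allI impI)
    fix y assume y: "y \<in> V"
    show "\<exists>r>0. d2.mball y r \<subseteq> V"
    proof (cases "sgn_smp y \<noteq> s \<and> 0 < radius y")
      case True
      \<comment> \<open>The ball around \<open>y\<close> through the origin stays on the ray of \<open>y\<close> without the origin.\<close>
      have "sgn_smp y' = sgn_smp y \<and> 0 < radius y'" if "d2 y y' < radius y" for y'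
        using that radius_nonneg[of y']
        by (cases "sgn_smp y = sgn_smp y'") (auto simp: d2_eq)
      moreover have "y' \<in> V" if "sgn_smp y' = sgn_smp y" "0 < radius y'" for y'
      proof -
        have "sgn_smp ?z = s \<or> radius ?z = 0"
          by (cases "0 < w") (auto simp: sgn_ray radius_ray)
        then show ?thesis using that True by (auto simp: V_def)
      qed
      ultimately have "d2.mball y (radius y) \<subseteq> V" by auto
      then show ?thesis using True by blast
    next
      case False
      have yw: "radius y < w"
      proof (cases "radius y = 0")
        case True
        then have "w \<noteq> 0" using y by (auto simp: V_def radius_eq_0_iff ray_nonpos)
        then show ?thesis using True w by simp
      qed (use False y radius_nonneg[of y] in \<open>auto simp: V_def less_le\<close>)
      have "radius y' < w" if "d2 y y' < w - radius y" for y'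
        using that radius_nonneg[of y] unfolding d2_eq by (smt (verit))
      then have "d2.mball y (w - radius y) \<subseteq> V"
        using w by (fastforce simp: V_def radius_ray)
      then show ?thesis using yw by (intro exI[of _ "w - radius y"]) auto
    qed
  qed auto
  moreover have "C \<subseteq> W \<union> V"
  proof
    fix y assume y: "y \<in> C"
    then have "y \<noteq> ?z" using z by blast
    then show "y \<in> W \<union> V"
      using eqz[of y] by (cases "radius y" w rule: linorder_cases) (auto simp: W_def V_def)
  qed
  moreover have "W \<inter> V = {}" by (auto simp: W_def V_def)
  moreover have "p \<in> W" using p by (simp add: W_def)
  moreover have "q \<in> V"
    using q z \<open>C \<subseteq> W \<union> V\<close> by (auto simp: W_def)
  ultimately show False
    using connectedinD[OF C, of W V] p(1) q(1) unfolding mtopology_d2 by blast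
qed

text \<open>Let \<open>p\<close> and \<open>q\<close> be distinct nearest points of \<open>x\<close>. They lie on the
  same side of \<open>x\<close> because the cut point \<open>x\<close> itself is not in \<open>C\<close>. On the outer side there is only
  one point at a given distance. On the inner side they cannot both be on the ray of \<open>x\<close>, so
  one of them has another sign. If that point is the origin, then no other point on the inner
  side is equally far from \<open>x\<close>. If it is not, then the origin is closer to \<open>x\<close> and hence not in \<open>C\<close>, so that
  \<open>C\<close> is confined to a ray other than that of \<open>x\<close>, where the distance to \<open>x\<close> determines the radius.\<close>

lemma nearest_point_unique:
  fixes d :: "smp \<Rightarrow> smp \<Rightarrow> real" and g :: "real \<Rightarrow> real \<Rightarrow> real"
  assumes same: "\<And>x y. sgn_smp x = sgn_smp y \<Longrightarrow> d x y = \<bar>radius x - radius y\<bar>"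
    and diff: "\<And>x y. sgn_smp x \<noteq> sgn_smp y \<Longrightarrow> d x y = g (radius x) (radius y)"
    and g_0: "\<And>u. 0 \<le> u \<Longrightarrow> g u 0 = u"
    and g_mono: "\<And>u v w. 0 \<le> u \<Longrightarrow> 0 \<le> v \<Longrightarrow> v < w \<Longrightarrow> g u v < g u w"
    and C: "connectedin smp_topology C"
    and p: "p \<in> C" "\<And>z. z \<in> C \<Longrightarrow> d x p \<le> d x z"
    and q: "q \<in> C" "\<And>z. z \<in> C \<Longrightarrow> d x q \<le> d x z"
  shows "p = q"
proof (rule ccontr)
  assume pq: "p \<noteq> q"
  have eq: "d x p = d x q" using p q by (simp add: order_antisym)
  have d_self: "d z z = 0" for z using same[of z z] by simp
  have g_pos: "0 < g u v" if "0 \<le> u" "0 < v" for u v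
    using g_mono[of u 0 v] g_0[of u] that by linarith
  have g_inj: "v = w" if "g u v = g u w" "0 \<le> u" "0 \<le> v" "0 \<le> w" for u v w
    using g_mono[of u v w] g_mono[of u w v] that by (cases v w rule: linorder_cases) auto
  have d_pos: "0 < d x z" if "z \<noteq> x" for z
  proof (cases "sgn_smp x = sgn_smp z")
    case True
    then show ?thesis using same[OF True] smp_eqI_radius[of x z] that by auto
  next
    case False
    have "0 < d x z" if "radius z = 0"
    proof -
      have "radius x \<noteq> 0" using that \<open>z \<noteq> x\<close> by (metis radius_eq_0_iff)
      then show ?thesis using diff[OF False] that g_0[of "radius x"] radius_nonneg[of x] by (simp add: less_le)
    qed
    then show ?thesis
      using diff[OF False] g_pos[of "radius x" "radius z"] radius_nonneg[of z] by (cases "radius z = 0") auto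
  qed
  have xC: "x \<notin> C"
  proof
    assume "x \<in> C"
    then have "d x p \<le> 0" "d x q \<le> 0" using p(2) q(2) d_self by force+
    then have "p = x" "q = x" using d_pos[of p] d_pos[of q] by force+
    then show False using pq by simp
  qed
  have d_0: "d x (bullet eps) = radius x"
    using same[of x "bullet eps"] diff[of x "bullet eps"] g_0 by (cases "sgn_smp x = sgn_smp (bullet eps)") auto
  define outer where "outer = (\<lambda>y. sgn_smp y = sgn_smp x \<and> radius x < radius y)"
  have outer_iff: "outer p \<longleftrightarrow> outer q"
    using connectedin_cut_point[OF C radius_nonneg[of x], of _ "sgn_smp x"] p(1) q(1) xC
    unfolding outer_def ray_sgn_radius by (meson not_less)
  have inner: "radius z \<le> radius x" if "\<not> outer z" "sgn_smp z = sgn_smp x" for z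
    using that by (auto simp: outer_def)
  have not_both: "\<not> (sgn_smp p = sgn_smp x \<and> sgn_smp q = sgn_smp x)"
  proof
    assume s: "sgn_smp p = sgn_smp x \<and> sgn_smp q = sgn_smp x"
    then have "\<bar>radius x - radius p\<bar> = \<bar>radius x - radius q\<bar>"
      using eq same[of x p] same[of x q] by simp
    moreover have "radius x < radius p \<longleftrightarrow> radius x < radius q"
      using outer_iff s by (simp add: outer_def)
    ultimately have "radius p = radius q" by linarith
    then show False using pq s smp_eqI_radius by metis
  qed
  have not_outer: "\<not> outer p" "\<not> outer q"
    using not_both outer_iff by (auto simp: outer_def)
  have other_ray: False
    if a: "a \<in> C" "\<And>z. z \<in> C \<Longrightarrow> d x a \<le> d x z" and b: "b \<in> C" "d x a = d x b" "a \<noteq> b"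
      and ax: "sgn_smp a \<noteq> sgn_smp x" and bo: "\<not> outer b" for a b
  proof (cases "radius a = 0")
    case True
    \<comment> \<open>Here \<open>a\<close> is the origin, the only point at distance \<open>radius x\<close> that is not beyond \<open>x\<close>.\<close>
    then have "d x b = radius x" using d_0 b(2) by (simp add: radius_eq_0_iff)
    have "radius b = 0"
    proof (cases "sgn_smp b = sgn_smp x")
      case s: True
      then show ?thesis
        using same[of x b] inner[OF bo s] \<open>d x b = radius x\<close> by simp
    next
      case s: False
      then have "g (radius x) (radius b) = g (radius x) 0"
        using diff[of x b] \<open>d x b = radius x\<close> g_0 by simp
      then show ?thesis by (rule g_inj) auto
    qed
    then show False using True b(3) by (metis radius_eq_0_iff)
  next
    case False
    then have pos: "0 < radius a" using radius_nonneg[of a] by linarith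
    then have "d x (bullet eps) < d x a"
      using d_0 diff[of x a] ax g_mono[of "radius x" 0 "radius a"] g_0[of "radius x"] by simp
    then have "bullet eps \<notin> C" using a(2) by force
    then have "sgn_smp b = sgn_smp a"
      using connectedin_cut_point[OF C order_refl a(1) refl pos b(1)] by (auto simp: ray_nonpos)
    moreover from this have "g (radius x) (radius a) = g (radius x) (radius b)"
      using diff[of x a] diff[of x b] b(2) ax by simp
    then have "radius a = radius b" by (rule g_inj) auto
    ultimately show False using b(3) smp_eqI_radius by metis
  qed
  show False
  proof (cases "sgn_smp p = sgn_smp x")
    case True
    then have "sgn_smp q \<noteq> sgn_smp x" using not_both by simp
    then show False
      using other_ray[OF q p(1) eq[symmetric]] pq not_outer by blast
  next
    case False
    then show False using other_ray[OF p q(1) eq pq] not_outer by blast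
  qed
qed

lemma connectedin_imp_Chebyshev_d1:
  assumes "C \<noteq> {}" "closedin smp_topology C" "connectedin smp_topology C"
  shows "d1.Chebyshev C"
proof -
  have "closedin d1.mtopology C" using assms(2) by (simp add: mtopology_d1)
  from d1.Chebyshev_iff_nearest_point_unique[OF compactin_mcball_d1 this assms(1)]
  show ?thesis
  proof (rule iffD2, intro ballI impI)
    fix x p q
    assume "p \<in> C" "q \<in> C" "\<forall>z\<in>C. d1 x p \<le> d1 x z" "\<forall>z\<in>C. d1 x q \<le> d1 x z"
    then show "p = q"
    proof (intro nearest_point_unique[where d = d1 and C = C and x = x
          and g = "\<lambda>u v. sqrt (u\<^sup>2 + u * v + v\<^sup>2)"])
      fix u v w :: real assume uvw: "0 \<le> u" "0 \<le> v" "v < w"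
      have "u * v \<le> u * w" "v\<^sup>2 < w\<^sup>2"
        using uvw by (auto intro: mult_left_mono power_strict_mono)
      then show "sqrt (u\<^sup>2 + u * v + v\<^sup>2) < sqrt (u\<^sup>2 + u * w + w\<^sup>2)"
        by simp
    qed (auto simp: d1_eq assms(3))
  qed
qed

lemma connectedin_imp_Chebyshev_d2:
  assumes "C \<noteq> {}" "closedin smp_topology C" "connectedin smp_topology C"
  shows "d2.Chebyshev C"
proof -
  have "closedin d2.mtopology C" using assms(2) by (simp add: mtopology_d2)
  from d2.Chebyshev_iff_nearest_point_unique[OF compactin_mcball_d2 this assms(1)]
  show ?thesis
  proof (rule iffD2, intro ballI impI)
    fix x p q
    assume "p \<in> C" "q \<in> C" "\<forall>z\<in>C. d2 x p \<le> d2 x z" "\<forall>z\<in>C. d2 x q \<le> d2 x z"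
    then show "p = q"
      by (intro nearest_point_unique[where d = d2 and C = C and x = x and g = "(+)"])
        (auto simp: d2_eq assms(3))
  qed
qed

theorem theorem77:
  fixes C :: "smp set"
  assumes "C \<noteq> {}" and "closedin smp_topology C"
  shows "(connectedin smp_topology C \<longleftrightarrow> Metric_space.Chebyshev UNIV d1 C)
       \<and> (connectedin smp_topology C \<longleftrightarrow> Metric_space.Chebyshev UNIV d2 C)"
proof (intro conjI iffI)
  show "connectedin smp_topology C" if "d1.Chebyshev C"
    using d1.Chebyshev_imp_connectedin[OF compactin_mcball_d1] that connected_space_smp assms(2)
    unfolding mtopology_d1 by blast
  show "connectedin smp_topology C" if "d2.Chebyshev C"
    using d2.Chebyshev_imp_connectedin[OF compactin_mcball_d2] that connected_space_smp assms(2)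
    unfolding mtopology_d2 by blast
qed (use assms connectedin_imp_Chebyshev_d1 connectedin_imp_Chebyshev_d2 in blast)+

end
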